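(* Let $n\ge 8$ be even and let $G_n$ be the graph obtained from the complete graph $K_n$ by deleting the edges of two vertex-disjoint cycles, each of length $n/2$ (equivalently, $G_n$ is the complement of the disjoint union of two cycles of length $n/2$). Then $G_n$ is not an autograph.
   Context: Let $G=(V,E)$ be a finite simple graph and $S$ a finite multiset of integers. $G$ is an autograph with signature $S$ if there is a bijection $\pi$ from the elements of $S$ (counted with multiplicity) to $V$ such that for any two distinct elements $s,t$ of $S$, the vertices $\pi(s),\pi(t)$ are adjacent if and only if $|s-t|\in S$. *)

theory Defs
  imports "HOL-Library.Multiset" "HOL-Library.Ramsey"
begin

text \<open>A finite simple graph is given by its vertex set \<open>V\<close> and its edge set
  \<open>E \<subseteq> [V]\<^bsup>2\<^esup>\<close>, the complete graph on \<open>V\<close> having edge set \<open>[V]\<^bsup>2\<^esup>\<close>.\<close>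

definition simple_graph :: "'a set \<Rightarrow> 'a set set \<Rightarrow> bool" where
  "simple_graph V E \<longleftrightarrow> finite V \<and> E \<subseteq> [V]\<^bsup>2\<^esup>"

text \<open>The \<open>i\<close>-th occurrence of \<open>s\<close> in \<open>S\<close> is the pair \<open>(s, i)\<close>, so that
  distinct occurrences of equal integers remain distinguishable.\<close>

definition occurrences :: "'b multiset \<Rightarrow> ('b \<times> nat) set" where
  "occurrences S = {(s, i). i < count S s}"

definition autograph_with_signature :: "'a set \<Rightarrow> 'a set set \<Rightarrow> int multiset \<Rightarrow> bool" where
  "autograph_with_signature V E S \<longleftrightarrow>
     (\<exists>\<pi>. bij_betw \<pi> (occurrences S) V \<and>
        (\<forall>p \<in> occurrences S. \<forall>q \<in> occurrences S. p \<noteq> q \<longrightarrow>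
           ({\<pi> p, \<pi> q} \<in> E \<longleftrightarrow> \<bar>fst p - fst q\<bar> \<in># S)))"

definition autograph :: "'a set \<Rightarrow> 'a set set \<Rightarrow> bool" where
  "autograph V E \<longleftrightarrow> (\<exists>S. autograph_with_signature V E S)"

text \<open>A cycle is given by the list of its vertices in cyclic order.\<close>

definition cycle_edges :: "'a list \<Rightarrow> 'a set set" where
  "cycle_edges xs = {{xs ! i, xs ! (Suc i mod length xs)} | i. i < length xs}"

definition is_cycle :: "'a set \<Rightarrow> 'a set set \<Rightarrow> 'a list \<Rightarrow> bool" where
  "is_cycle V E xs \<longleftrightarrow>
     3 \<le> length xs \<and> distinct xs \<and> set xs \<subseteq> V \<and> cycle_edges xs \<subseteq> E"

lemma simple_graph_complete_minus: "finite V \<Longrightarrow> simple_graph V ([V]\<^bsup>2\<^esup> - F)"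
  by (auto simp: simple_graph_def)

lemma cycle_edges_complete:
  assumes "3 \<le> length xs" "distinct xs" "set xs \<subseteq> V"
  shows "cycle_edges xs \<subseteq> [V]\<^bsup>2\<^esup>"
proof -
  have "{xs ! i, xs ! (Suc i mod length xs)} \<in> [V]\<^bsup>2\<^esup>" if i: "i < length xs" for i
  proof -
    have j: "Suc i mod length xs < length xs" "i \<noteq> Suc i mod length xs"
      using i assms(1) by (auto simp: mod_Suc)
    then have "xs ! i \<noteq> xs ! (Suc i mod length xs)"
      using assms(2) i by (simp add: nth_eq_iff_index_eq)
    moreover have "xs ! i \<in> V" "xs ! (Suc i mod length xs) \<in> V"
      using i j(1) assms(3) by (meson nth_mem subsetD)+
    ultimately show ?thesis by (auto simp: nsets_def)
  qed
  then show ?thesis by (auto simp: cycle_edges_def)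
qed

end

theory Submission imports Defs begin

text \<open>
  Let \<open>H\<close> be the complement of the graph, a disjoint union of two cycles; it is 2-regular,
  triangle-free and disconnected, and \<open>s, t\<close> are joined in \<open>H\<close> iff \<open>\<bar>s - t\<bar>\<close> is not in the
  signature. Let \<open>w\<close> be the smallest element. If \<open>w < 0\<close> and \<open>-w\<close> is not in the signature, then
  each \<open>t\<close> is joined to \<open>t - w\<close> or, if that is not in the signature, to \<open>w\<close>, so \<open>H\<close> is connected;
  hence \<open>-w\<close> is in the signature. This and 2-regularity exclude \<open>0\<close>, and then triangle-freeness
  excludes repeated elements, so the signature is a set \<open>T\<close>.

  Put \<open>d = \<bar>w\<bar>\<close>. Since \<open>w\<close> has exactly two \<open>H\<close>-neighbours, \<open>T\<close> is the disjoint union of three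
  arithmetic progressions (chains) with difference \<open>d\<close>. Adjacency in \<open>H\<close> depends only on
  differences, so between two chains it is invariant under simultaneous translation: it is a union
  of full diagonals. Being 2-regular, such a graph can be followed from the ends of the chains
  until some vertex has the wrong degree. The one configuration that survives is
  \<open>T = d \<cdot> ({1..m} - {\<alpha>, \<beta>})\<close>, where \<open>H\<close> joins the elements at distance \<open>\<alpha> d\<close> or \<open>\<beta> d\<close>; it is
  excluded directly.
\<close>

section \<open>Translation-invariant graphs on three chains\<close>

text \<open>The vertex \<open>(c, i)\<close> stands for the \<open>i\<close>-th element of the \<open>c\<close>-th of three chains, and
  \<open>adj\<close> for adjacency in the complement \<open>H\<close>.\<close>

locale chain_graph =
  fixes len :: "nat \<Rightarrow> int"
    and adj :: "nat \<Rightarrow> int \<Rightarrow> nat \<Rightarrow> int \<Rightarrow> bool"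
  assumes adj_vertex: "adj c i c' j \<Longrightarrow> c < 3 \<and> 0 \<le> i \<and> i < len c"
    and adj_sym: "adj c i c' j \<Longrightarrow> adj c' j c i"
    and adj_translate: "\<lbrakk>adj c i c' j; 0 \<le> i'; i' < len c; 0 \<le> j'; j' < len c'; j' - i' = j - i\<rbrakk>
      \<Longrightarrow> adj c i' c' j'"
    and degree: "\<lbrakk>c < 3; 0 \<le> i; i < len c\<rbrakk> \<Longrightarrow> card {(c', j). adj c i c' j} = 2"
begin

lemma adj_vertex': "adj c i c' j \<Longrightarrow> c' < 3 \<and> 0 \<le> j \<and> j < len c'"
  using adj_sym adj_vertex by blast

text \<open>Upper half of 2-regularity. The local facts called \<open>full...\<close> below are
  instances of it, recording that a vertex has used up its two neighbours; \<open>other_adj\<close>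
  and \<open>two_adj\<close> are the lower half.\<close>

lemma adj_full:
  assumes "adj c i c1 j1" "adj c i c2 j2" "c1 \<noteq> c2 \<or> j1 \<noteq> j2" "adj c i c3 j3"
  shows "c3 = c1 \<and> j3 = j1 \<or> c3 = c2 \<and> j3 = j2"
proof -
  have "card {(c', j). adj c i c' j} = 2"
    using adj_vertex[OF assms(1)] degree by blast
  then obtain x y where xy: "{(c', j). adj c i c' j} = {x, y}"
    by (auto simp: card_2_iff)
  have "(c1, j1) \<in> {x, y}" "(c2, j2) \<in> {x, y}" "(c3, j3) \<in> {x, y}"
    unfolding xy[symmetric] using assms by auto
  then show ?thesis
    using assms(3) by auto
qed

lemma other_adj:
  assumes "c < 3" "0 \<le> i" "i < len c"
  shows "\<exists>c' j. adj c i c' j \<and> (c' \<noteq> c1 \<or> j \<noteq> j1)"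
proof -
  have "card {(c', j). adj c i c' j} = 2"
    using assms degree by blast
  then obtain x y where xy: "{(c', j). adj c i c' j} = {x, y}" "x \<noteq> y"
    by (auto simp: card_2_iff)
  then have "adj c i (fst x) (snd x)" "adj c i (fst y) (snd y)"
    by (auto simp: case_prod_beta set_eq_iff)
  then show ?thesis
    using xy(2) by (metis prod.collapse)
qed

lemma two_adj:
  assumes "c < 3" "0 \<le> i" "i < len c"
  shows "\<exists>c1 j1 c2 j2. adj c i c1 j1 \<and> adj c i c2 j2 \<and> (c1 \<noteq> c2 \<or> j1 \<noteq> j2)"
  by (metis other_adj assms)

section \<open>Chain configurations arising from a positive minimum\<close>

text \<open>When chain 0 is just \<open>{d}\<close>, the value \<open>2 * d\<close> is absent from
  \<open>T\<close>, which is the source of \<open>two\<close>. Edges are forced upwards from the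
  chain starts until \<open>g\<close> is a single vertex and the last vertex of \<open>f\<close>
  lacks a second neighbour.\<close>

lemma first_chain_singleton_aux:
  assumes fg: "{f, g} = {1, 2 :: nat}"
    and len: "len 0 = 1" "len g \<ge> 1" "len f \<ge> 4" "len f + len g \<ge> 7" "odd (len f + len g)"
    and f0: "adj 0 0 f 0" and g0: "adj 0 0 g 0"
    and two: "\<And>c i. \<lbrakk>c \<in> {1, 2}; 0 \<le> i; i + 2 < len c\<rbrakk> \<Longrightarrow> adj c i c (i + 2)"
  shows False
proof -
  have ids: "f \<noteq> g" "f \<noteq> 0" "g \<noteq> 0" "f < 3" "g < 3"
    using fg by (auto simp: doubleton_eq_iff)
  have mem: "f \<in> {1, 2}" "g \<in> {1, 2}"
    using fg by auto
  have cs: "c = 0 \<or> c = f \<or> c = g" if "c < 3" for c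
    using fg that by (auto simp: doubleton_eq_iff)
  have full00: "c = f \<and> j = 0 \<or> c = g \<and> j = 0" if "adj 0 0 c j" for c j
    using adj_full[OF f0 g0 _ that] ids by auto
  have f02: "adj f 0 f 2"
    using two[OF mem(1), of 0] len by simp
  have fullf0: "c = 0 \<and> j = 0 \<or> c = f \<and> j = 2" if "adj f 0 c j" for c j
    using adj_full[OF adj_sym[OF f0] f02 _ that] ids by auto
  \<comment> \<open>An edge inside \<open>f\<close> translates down to one at \<open>(f, 0)\<close>,
    whose only neighbour within \<open>f\<close> is at position 2.\<close>
  have ff: "j = i + 2 \<or> i = j + 2" if "adj f i f j" for i j
  proof (cases "i \<le> j")
    case True
    then have "adj f 0 f (j - i)"
      using adj_translate[OF that, of 0 "j - i"] adj_vertex[OF that] adj_vertex'[OF that] by auto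
    then show ?thesis using fullf0 ids by force
  next
    case False
    then have "adj f 0 f (i - j)"
      using adj_translate[OF adj_sym[OF that], of 0 "i - j"] adj_vertex[OF that] adj_vertex'[OF that] by auto
    then show ?thesis using fullf0 ids by force
  qed
  \<comment> \<open>The second neighbour of \<open>(f, 1)\<close>, besides \<open>(f, 3)\<close>,
    can only lie in \<open>g\<close>, and there only at position 0: a later position would translate
    down to a third neighbour of \<open>(f, 0)\<close>.\<close>
  obtain c j where cj: "adj f 1 c j" "c \<noteq> f \<or> j \<noteq> 3"
    using other_adj[of f 1 f "3"] len ids by auto
  have "c \<noteq> 0"
  proof
    assume "c = 0"
    moreover from this have "j = 0" using adj_vertex'[OF cj(1)] len by auto
    ultimately show False using full00 adj_sym[OF cj(1)] ids by force
  qed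
  moreover have "c \<noteq> f"
    using ff cj adj_vertex'[OF cj(1)] by force
  ultimately have c: "c = g" using cs adj_vertex'[OF cj(1)] by blast
  have j0: "j = 0"
  proof (rule ccontr)
    assume "j \<noteq> 0"
    then have "adj f 0 g (j - 1)"
      using adj_translate[OF cj(1), of 0 "j - 1"] adj_vertex'[OF cj(1)] len c by auto
    then show False using fullf0 ids by force
  qed
  have f1g0: "adj f 1 g 0" using cj c j0 by simp
  have fullg0: "c = 0 \<and> j = 0 \<or> c = f \<and> j = 1" if "adj g 0 c j" for c j
    using adj_full[OF adj_sym[OF g0] adj_sym[OF f1g0] _ that] ids by auto
  have "len g \<le> 2"
  proof (rule ccontr)
    assume "\<not> len g \<le> 2"
    then have "adj g 0 g 2" using two[OF mem(2), of 0] by simp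
    then show False using fullg0 ids by force
  qed
  then have lf: "len f \<ge> 5" using len by linarith
  have lg: "len g = 1"
  proof (rule ccontr)
    assume "len g \<noteq> 1"
    then have "adj f 2 g 1"
      using adj_translate[OF f1g0, of 2 1] len \<open>len g \<le> 2\<close> by auto
    moreover have "adj f 2 f 0" "adj f 2 f 4"
      using adj_sym[OF f02] two[OF mem(1), of 2] lf by simp_all
    ultimately show False using adj_full[of f 2 f 0 f 4 g 1] ids by auto
  qed
  \<comment> \<open>At the top of \<open>f\<close> there is no vertex two steps up, and the vertices
    of the two singleton chains already have both their neighbours.\<close>
  obtain c j where cj: "adj f (len f - 1) c j" "c \<noteq> f \<or> j \<noteq> len f - 3"
    using other_adj[of f "len f - 1" f "len f - 3"] len ids by auto
  have "c \<noteq> 0"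
  proof
    assume "c = 0"
    moreover from this have "j = 0" using adj_vertex'[OF cj(1)] len by auto
    ultimately show False using full00 adj_sym[OF cj(1)] ids lf by force
  qed
  moreover have "c \<noteq> f"
    using ff cj adj_vertex'[OF cj(1)] by force
  moreover have "c \<noteq> g"
  proof
    assume "c = g"
    moreover from this have "j = 0" using adj_vertex'[OF cj(1)] lg by auto
    ultimately show False using fullg0 adj_sym[OF cj(1)] ids lf by force
  qed
  ultimately show False using cs adj_vertex'[OF cj(1)] by blast
qed

lemma first_chain_singleton:
  assumes len: "len 0 = 1" "len 1 \<ge> 1" "len 2 \<ge> 1" "len 1 + len 2 \<ge> 7" "odd (len 1 + len 2)"
    and start: "adj 0 0 1 0" "adj 0 0 2 0"
    and two: "\<And>c i. \<lbrakk>c \<in> {1, 2}; 0 \<le> i; i + 2 < len c\<rbrakk> \<Longrightarrow> adj c i c (i + 2)"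
  shows False
proof (cases "len 1 \<ge> 4")
  case True
  then show False
    using first_chain_singleton_aux[of 1 2] assms by auto
next
  case False
  then show False
    using first_chain_singleton_aux[of 2 1] assms by (auto simp: add.commute)
qed

text \<open>The conclusion is the shape left over by the degree conditions; it is refuted later from
  the values of the chain starts. The hypothesis \<open>near\<close> reflects that
  \<open>d, ..., len 0 * d\<close> all lie in \<open>T\<close>.\<close>

lemma other_chain_singleton:
  assumes fg: "{f, g} = {1, 2 :: nat}"
    and len: "len 0 \<ge> 2" "len g = 1" "len f \<ge> 1" "len 0 + len f \<ge> 7" "odd (len 0 + len f)"
    and f0: "adj 0 0 f 0" and g0: "adj 0 0 g 0"
    and near: "\<And>c i j. adj c i c j \<Longrightarrow> \<bar>i - j\<bar> > len 0"
  shows "\<not> adj 0 1 g 0 \<and> adj 0 (len 0 - 1) g 0 \<and> len f = len 0 - 1"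
proof -
  define k l where "k = len 0" and "l = len f"
  have ids: "f \<noteq> g" "f \<noteq> 0" "g \<noteq> 0" "f < 3" "g < 3"
    using fg by (auto simp: doubleton_eq_iff)
  have cs: "c = 0 \<or> c = f \<or> c = g" if "c < 3" for c
    using fg that by (auto simp: doubleton_eq_iff)
  have no00: "\<not> adj 0 i 0 j" for i j
    using near[of 0 i j] adj_vertex[of 0 i 0 j] adj_vertex'[of 0 i 0 j] by auto
  have full00: "c = f \<and> j = 0 \<or> c = g \<and> j = 0" if "adj 0 0 c j" for c j
    using adj_full[OF f0 g0 _ that] ids by auto
  \<comment> \<open>Edges from chain 0 to \<open>f\<close> never climb, since pushing one down to
    \<open>(0, 0)\<close> would give that vertex a neighbour beyond position 0 of \<open>f\<close>.
    Hence each such edge is a translate of an edge at \<open>(f, 0)\<close>.\<close>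
  have no_up: "j \<le> i" if "adj 0 i f j" for i j
  proof (rule ccontr)
    assume "\<not> j \<le> i"
    then have "adj 0 0 f (j - i)"
      using adj_translate[OF that, of 0 "j - i"] adj_vertex[OF that] adj_vertex'[OF that] len by auto
    then show False using full00 ids \<open>\<not> j \<le> i\<close> by force
  qed
  have to0: "adj 0 (i - j) f 0" if "adj 0 i f j" for i j
    using adj_translate[OF that, of "i - j" 0] adj_vertex[OF that] adj_vertex'[OF that]
      no_up[OF that] len by auto
  have fup: "adj f 0 f \<bar>j - i\<bar>" if "adj f i f j" for i j
    using adj_translate[OF that, of 0 "j - i"] adj_translate[OF adj_sym[OF that], of 0 "i - j"]
      adj_vertex[OF that] adj_vertex'[OF that] len by (auto simp: abs_if)
  have gj: "j = 0" if "adj c i g j" for c i j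
    using adj_vertex'[OF that] len by auto
  \<comment> \<open>If \<open>f\<close> were a single vertex, every vertex of chain 0 would need it
    as a neighbour, which is too many.\<close>
  have l2: "l \<ge> 2"
  proof (rule ccontr)
    assume "\<not> l \<ge> 2"
    then have l1: "len f = 1" using len l_def by auto
    have "adj 0 i f 0" if i: "0 \<le> i" "i < len 0" for i
    proof -
      obtain c j where cj: "adj 0 i c j" "c \<noteq> g \<or> j \<noteq> 0"
        using other_adj[of 0 i g "0"] i by auto
      then have "c = f"
        using cs[of c] adj_vertex'[OF cj(1)] no00 gj by blast
      moreover from this have "j = 0" using adj_vertex'[OF cj(1)] l1 by auto
      ultimately show ?thesis using cj by simp
    qed
    from this[of 0] this[of 1] this[of 2] show False
      using adj_full[of f 0 0 0 0 1 0 2] adj_sym len l1 by auto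
  qed
  have f1: "adj 0 1 f 1"
    using adj_translate[OF f0, of 1 1] len l2 l_def by auto
  have neg: "\<not> adj 0 1 g 0"
  proof
    assume g1: "adj 0 1 g 0"
    have fullg: "c = 0 \<and> (j = 0 \<or> j = 1)" if "adj g 0 c j" for c j
      using adj_full[OF adj_sym[OF g0] adj_sym[OF g1] _ that] by auto
    have full01: "c = f \<and> j = 1 \<or> c = g \<and> j = 0" if "adj 0 1 c j" for c j
      using adj_full[OF f1 g1 _ that] ids by auto
    \<comment> \<open>For \<open>k \<ge> 3\<close> the edges from chain 0 to \<open>f\<close>
      descend by 0 or 2, which makes \<open>f\<close> longer than chain 0 and leaves
      \<open>(f, k)\<close> without neighbours. For \<open>k = 2\<close> both neighbours of
      \<open>(f, 2)\<close> lie higher in \<open>f\<close>; translated down, they overload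
      \<open>(f, 0)\<close>.\<close>
    show False
    proof (cases "k \<ge> 3")
      case True
      have shape: "c = f \<and> (j = i \<or> j \<le> i - 2)" if a: "adj 0 i c j" and "i \<ge> 2" for c i j
      proof -
        have c: "c = f"
          using cs[of c] adj_vertex'[OF a] no00 gj a fullg adj_sym[OF a] that ids by fastforce
        then have "j \<noteq> i - 1"
          using to0[of i j] a full01 ids by force
        then show ?thesis using c no_up a by force
      qed
      have 02: "adj 0 2 f 0"
      proof -
        obtain c j where cj: "adj 0 2 c j" "c \<noteq> f \<or> j \<noteq> 2"
          using other_adj[of 0 2 f "2"] True k_def by auto
        then show ?thesis
          using shape[OF cj(1)] adj_vertex'[OF cj(1)] by force
      qed
      have fullf: "c = 0 \<and> (j = 0 \<or> j = 2)" if "adj f 0 c j" for c j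
        using adj_full[OF adj_sym[OF f0] adj_sym[OF 02] _ that] by auto
      have shape2: "c = f \<and> (j = i \<or> j = i - 2)" if a: "adj 0 i c j" and "i \<ge> 2" for c i j
        using shape[OF that] to0[of i j] a fullf[OF adj_sym[OF to0[of i j]]] by force
      have "l \<ge> k"
      proof -
        obtain c j where cj: "adj 0 (k - 1) c j" "c \<noteq> f \<or> j \<noteq> k - 3"
          using other_adj[of 0 "k - 1" f "k - 3"] True k_def by auto
        then show ?thesis
          using shape2[OF cj(1)] adj_vertex'[OF cj(1)] True l_def by force
      qed
      \<comment> \<open>Equality is excluded by the parity of \<open>len 0 + len f\<close>.\<close>
      then have "l > k" using len k_def l_def by (cases "l = k") auto
      then obtain c j where cj: "adj f k c j"
        using other_adj[of f k 0 0] ids k_def l_def len by auto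
      have "c \<noteq> 0" using no_up[of j k] adj_sym[OF cj] adj_vertex'[OF cj] k_def by (cases "c = 0") auto
      moreover have "c \<noteq> f" using fup[of k j] fullf cj ids by force
      moreover have "c \<noteq> g" using gj[of f k j] fullg[of f k] cj adj_sym[OF cj] ids by (cases "c = g") auto
      ultimately show False using cs adj_vertex'[OF cj] by blast
    next
      case False
      then have k2: "k = 2" and l5: "l \<ge> 5" using len k_def l_def by auto
      have shape: "c = f \<and> j > 2" if a: "adj f 2 c j" for c j
      proof -
        have "c \<noteq> g" using gj[of f 2 j] fullg[of f 2] a adj_sym[OF a] ids by (cases "c = g") auto
        moreover have "c \<noteq> 0"
        proof
          assume "c = 0"
          then have "j \<ge> 2" using no_up[of j 2] adj_sym[OF a] by auto
          then show False using adj_vertex'[OF a] \<open>c = 0\<close> k2 k_def by auto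
        qed
        ultimately have "c = f" using cs adj_vertex'[OF a] by blast
        then show ?thesis using near[of f 2 j] a k2 k_def adj_vertex'[OF a] by auto
      qed
      obtain c1 j1 c2 j2 where
        "adj f 2 c1 j1" "adj f 2 c2 j2" "c1 \<noteq> c2 \<or> j1 \<noteq> j2"
        using two_adj[of f 2] ids l5 l_def by auto
      then have "adj f 2 f j1" "adj f 2 f j2" "j1 \<noteq> j2" "j1 > 2" "j2 > 2"
        using shape by blast+
      then have "adj f 0 f (j1 - 2)" "adj f 0 f (j2 - 2)" "j1 - 2 \<noteq> j2 - 2"
        using fup[of 2 j1] fup[of 2 j2] by auto
      then show False using adj_full[of f 0 f "j1 - 2" f "j2 - 2" 0 0] adj_sym[OF f0] ids by auto
    qed
  qed
  have 01: "adj 0 1 f 0"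
  proof -
    obtain c j where cj: "adj 0 1 c j" "c \<noteq> f \<or> j \<noteq> 1"
      using other_adj[of 0 1 f "1"] len by auto
    have "c = f" using cs[of c] adj_vertex'[OF cj(1)] no00 gj cj(1) neg by metis
    moreover from this have "j = 0"
      using no_up[of 1 j] cj adj_vertex'[OF cj(1)] by auto
    ultimately show ?thesis using cj by simp
  qed
  have fullf: "c = 0 \<and> (j = 0 \<or> j = 1)" if "adj f 0 c j" for c j
    using adj_full[OF adj_sym[OF f0] adj_sym[OF 01] _ that] by auto
  have "l \<le> k"
  proof (rule ccontr)
    assume "\<not> l \<le> k"
    then obtain c j where cj: "adj f k c j" "c \<noteq> g \<or> j \<noteq> 0"
      using other_adj[of f k g "0"] ids k_def l_def len by auto
    have "c \<noteq> 0" using no_up[of j k] adj_sym[OF cj(1)] adj_vertex'[OF cj(1)] k_def by (cases "c = 0") auto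
    moreover have "c \<noteq> f" using fup[of k j] fullf cj ids by force
    moreover have "c \<noteq> g" using gj cj by blast
    ultimately show False using cs adj_vertex'[OF cj(1)] by blast
  qed
  then have lk: "l < k" using len k_def l_def by (cases "l = k") auto
  \<comment> \<open>Edges from chain 0 to \<open>f\<close> descend by 0 or 1, and
    \<open>l < k\<close> rules out descent 0 at the top of chain 0. Both remaining candidates must
    then be neighbours.\<close>
  have shape: "c = g \<and> j = 0 \<or> c = f \<and> j = k - 2" if a: "adj 0 (k - 1) c j" for c j
  proof (cases "c = f")
    case True
    then have "k - 1 - j = 0 \<or> k - 1 - j = 1"
      using to0[of "k - 1" j] a fullf[OF adj_sym[OF to0[of "k - 1" j]]] by auto
    then show ?thesis using adj_vertex'[OF a] True lk l_def by auto
  next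
    case False
    then show ?thesis using cs[of c] adj_vertex'[OF a] no00 gj a by blast
  qed
  obtain c j where "adj 0 (k - 1) c j" "c \<noteq> f \<or> j \<noteq> k - 2"
    using other_adj[of 0 "k - 1" f "k - 2"] len k_def by auto
  then have "adj 0 (k - 1) g 0" using shape by blast
  moreover obtain c j where "adj 0 (k - 1) c j" "c \<noteq> g \<or> j \<noteq> 0"
    using other_adj[of 0 "k - 1" g "0"] len k_def by auto
  then have "adj 0 (k - 1) f (k - 2)" using shape by blast
  then have "k - 2 < l" using adj_vertex' l_def by blast
  ultimately show ?thesis using neg lk k_def l_def by auto
qed

section \<open>The chain configuration arising from a negative minimum\<close>

text \<open>Chain 0 is the minimum alone, an apex joined to the last vertices of the other chains,
  so edges are followed downwards. If \<open>f\<close> is a single vertex, it gets three neighbours.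
  Otherwise all edges between \<open>f\<close> and \<open>g\<close> lie on the two diagonals beside
  the one through both last vertices, and the first vertices then require both \<open>k < l\<close>
  and \<open>l < k\<close>.\<close>

lemma apex_with_two_chains:
  assumes fg: "{f, g} = {1, 2 :: nat}"
    and len: "len 0 = 1" "len f \<ge> 1" "len g \<ge> 1" "len f + len g \<ge> 7" "odd (len f + len g)"
    and fe: "adj 0 0 f (len f - 1)" and ge: "adj 0 0 g (len g - 1)"
    and noff: "\<And>i j. \<not> adj f i f j"
    and two: "\<And>i. \<lbrakk>len f = 1; 0 \<le> i; i + 2 < len g\<rbrakk> \<Longrightarrow> adj g i g (i + 2)"
  shows False
proof -
  define k l where "k = len f" and "l = len g"
  have ids: "f \<noteq> g" "f \<noteq> 0" "g \<noteq> 0" "f < 3" "g < 3"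
    using fg by (auto simp: doubleton_eq_iff)
  have cs: "c = 0 \<or> c = f \<or> c = g" if "c < 3" for c
    using fg that by (auto simp: doubleton_eq_iff)
  have full00: "c = f \<and> j = k - 1 \<or> c = g \<and> j = l - 1" if "adj 0 0 c j" for c j
    using adj_full[OF fe ge _ that] ids k_def l_def by auto
  have to0: "c = f \<and> i = k - 1 \<or> c = g \<and> i = l - 1" if "adj c i 0 j" for c i j
    using full00[of c i] adj_sym[OF that] adj_vertex'[OF that] len by (cases "j = 0") auto
  \<comment> \<open>An edge inside \<open>g\<close> is pushed up until its upper end is the last
    vertex.\<close>
  have gup: "adj g (l - 1) g (l - 1 - \<bar>i - j\<bar>)" if "adj g i g j" for i j
    using adj_translate[OF that, of "l - 1" "l - 1 - (i - j)"]
      adj_translate[OF adj_sym[OF that], of "l - 1" "l - 1 - (j - i)"]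
      adj_vertex[OF that] adj_vertex'[OF that] l_def by (auto simp: abs_if)
  show False
  proof (cases "k = 1")
    case True
    then have l6: "l \<ge> 6" using len k_def l_def by auto
    have "adj g (l - 3) g (l - 1)" using two[of "l - 3"] True k_def l6 l_def by auto
    then have fullg: "c = 0 \<and> j = 0 \<or> c = g \<and> j = l - 3" if "adj g (l - 1) c j" for c j
      using adj_full[of g "l - 1" 0 0 g "l - 3" c j] adj_sym[of g "l - 3" g "l - 1"]
        adj_sym[OF ge] that ids l_def by auto
    have small: "adj g i f 0" if i: "0 \<le> i" "i < 2" for i
    proof -
      obtain c j where cj: "adj g i c j" "c \<noteq> g \<or> j \<noteq> i + 2"
        using other_adj[of g i g "i + 2"] ids i l6 l_def by auto
      have "c \<noteq> 0" using to0[of g i j] cj ids i l6 by (cases "c = 0") auto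
      moreover have "c \<noteq> g"
        using gup[of i j] fullg[of g "l - 1 - \<bar>i - j\<bar>"] cj ids i adj_vertex'[OF cj(1)] by (cases "c = g") auto
      ultimately have "c = f" using cs adj_vertex'[OF cj(1)] by blast
      moreover from this have "j = 0" using adj_vertex'[OF cj(1)] True k_def by auto
      ultimately show ?thesis using cj by simp
    qed
    show False
      using adj_full[of f 0 g 0 g 1 0 0] small[of 0] small[of 1] adj_sym fe True k_def ids by auto
  next
    case False
    then have k2: "k \<ge> 2" using len k_def by auto
    obtain c1 j1 c2 j2 where n12:
      "adj f (k - 2) c1 j1" "adj f (k - 2) c2 j2" "c1 \<noteq> c2 \<or> j1 \<noteq> j2"
      using two_adj[of f "k - 2"] ids k2 k_def by auto
    have fk2: "c = g" if "adj f (k - 2) c j" for c j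
      using cs[of c] adj_vertex'[OF that] that noff to0[of f "k - 2" j] ids by auto
    have n: "adj f (k - 2) g j1" "adj f (k - 2) g j2" "j1 \<noteq> j2"
      using n12 fk2 by blast+
    have l2: "l \<ge> 2" using adj_vertex'[OF n(1)] adj_vertex'[OF n(2)] n(3) l_def by auto
    \<comment> \<open>Otherwise both edges could be shifted up by one, giving
      \<open>(f, k - 1)\<close> two neighbours in addition to the apex.\<close>
    have "j1 = l - 1 \<or> j2 = l - 1"
    proof (rule ccontr)
      assume "\<not> ?thesis"
      then have "adj f (k - 1) g (j1 + 1)" "adj f (k - 1) g (j2 + 1)"
        using adj_translate[OF n(1), of "k - 1" "j1 + 1"] adj_translate[OF n(2), of "k - 1" "j2 + 1"]
          adj_vertex'[OF n(1)] adj_vertex'[OF n(2)] k2 k_def l_def by auto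
      then show False
        using adj_full[of f "k - 1" g "j1 + 1" g "j2 + 1" 0 0] adj_sym[OF fe] n(3) ids k_def by auto
    qed
    then have fkg: "adj f (k - 2) g (l - 1)" using n by blast
    have fullg: "c = 0 \<and> j = 0 \<or> c = f \<and> j = k - 2" if "adj g (l - 1) c j" for c j
      using adj_full[of g "l - 1" 0 0 f "k - 2" c j] adj_sym[OF ge] adj_sym[OF fkg] that ids l_def by auto
    have nogg: "\<not> adj g i g j" for i j
      using gup[of i j] fullg ids by force
    have gl2: "c = f \<and> (j = k - 3 \<or> j = k - 1)" if a: "adj g (l - 2) c j" for c j
    proof -
      have c: "c = f"
        using cs[of c] adj_vertex'[OF a] a nogg to0[of g "l - 2" j] ids by auto
      have "j + 1 = k - 2" if "j \<noteq> k - 1"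
      proof -
        have "adj g (l - 1) f (j + 1)"
          using adj_translate[OF a, of "l - 1" "j + 1"] adj_vertex'[OF a] that c k_def l_def l2 by auto
        then show ?thesis using fullg ids by force
      qed
      then show ?thesis using c by force
    qed
    obtain c1 j1 c2 j2 where
      "adj g (l - 2) c1 j1" "adj g (l - 2) c2 j2" "c1 \<noteq> c2 \<or> j1 \<noteq> j2"
      using two_adj[of g "l - 2"] ids l2 l_def by auto
    then have gk: "adj g (l - 2) f (k - 1)"
      using gl2 by metis
    have fullf: "c = 0 \<and> j = 0 \<or> c = g \<and> j = l - 2" if "adj f (k - 1) c j" for c j
      using adj_full[of f "k - 1" 0 0 g "l - 2" c j] adj_sym[OF fe] adj_sym[OF gk] that ids k_def by auto
    \<comment> \<open>The edge is shifted up until one of the chains reaches its last vertex; the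
      neighbours of both last vertices are known.\<close>
    have diag: "j - i = l - k - 1 \<or> j - i = l - k + 1" if a: "adj f i g j" for i j
    proof (cases "k - 1 - i \<le> l - 1 - j")
      case True
      then have "adj f (k - 1) g (k - 1 - i + j)"
        using adj_translate[OF a, of "k - 1" "k - 1 - i + j"] adj_vertex[OF a] adj_vertex'[OF a]
          k_def l_def by auto
      then show ?thesis using fullf ids by force
    next
      case False
      then have "adj g (l - 1) f (l - 1 - j + i)"
        using adj_translate[OF adj_sym[OF a], of "l - 1" "l - 1 - j + i"] adj_vertex[OF a] adj_vertex'[OF a]
          k_def l_def by auto
      then show ?thesis using fullg ids by force
    qed
    \<comment> \<open>As \<open>k \<ge> 2\<close>, the vertex \<open>(f, 0)\<close> is not joined to
      the apex, so it needs a neighbour on each diagonal, and the lower one must exist. The same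
      argument at \<open>(g, 0)\<close> gives the opposite inequality.\<close>
    have "l - k - 1 \<ge> 0"
    proof -
      obtain c j where cj: "adj f 0 c j" "c \<noteq> g \<or> j \<noteq> l - k + 1"
        using other_adj[of f 0 g "l - k + 1"] ids k2 k_def by auto
      have "c = g" using cs[of c] adj_vertex'[OF cj(1)] cj noff to0[of f 0 j] ids k2 by auto
      then show ?thesis using diag[of 0 j] cj adj_vertex'[OF cj(1)] by auto
    qed
    moreover have "k - l - 1 \<ge> 0"
    proof -
      obtain c j where cj: "adj g 0 c j" "c \<noteq> f \<or> j \<noteq> k - l + 1"
        using other_adj[of g 0 f "k - l + 1"] ids l2 l_def by auto
      have "c = f" using cs[of c] adj_vertex'[OF cj(1)] cj nogg to0[of g 0 j] ids l2 by auto
      then show ?thesis using diag[of j 0] adj_sym[OF cj(1)] cj adj_vertex'[OF cj(1)] by auto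
    qed
    ultimately show False by linarith
  qed
qed

end

section \<open>Sets of integers\<close>

lemma three_in_pair:
  assumes "card A = 2" "x \<in> A" "y \<in> A" "z \<in> A"
  shows "x = y \<or> x = z \<or> y = z"
  using assms by (auto simp: card_2_iff)

lemma other_in_pair:
  assumes "card A = 2"
  shows "\<exists>y \<in> A. y \<noteq> x"
  using assms by (auto simp: card_2_iff)

section \<open>Splitting a finite set into arithmetic progressions\<close>

text \<open>Translation by \<open>d\<close> matches the elements that have a successor with those
  that have a predecessor. This is needed where the degree of the minimum counts chain ends, while
  the decomposition is indexed by starts.\<close>

lemma card_chain_starts:
  fixes T :: "int set"
  assumes "finite T"
  shows "card {t \<in> T. t - d \<notin> T} = card {t \<in> T. t + d \<notin> T}"
proof -
  have "(\<lambda>t. t + d) ` {t \<in> T. t + d \<in> T} = {t \<in> T. t - d \<in> T}"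
    by (force simp: image_iff)
  then have "card {t \<in> T. t + d \<in> T} = card {t \<in> T. t - d \<in> T}"
    by (metis (no_types, lifting) add_right_cancel card_image inj_onI)
  moreover have "card T = card {t \<in> T. P t} + card {t \<in> T. \<not> P t}" for P
    using assms by (subst card_Un_disjoint[symmetric]) (auto intro!: arg_cong[of _ _ card])
  from this[of "\<lambda>t. t + d \<in> T"] this[of "\<lambda>t. t - d \<in> T"]
  have "card T = card {t \<in> T. t + d \<in> T} + card {t \<in> T. t + d \<notin> T}"
    "card T = card {t \<in> T. t - d \<in> T} + card {t \<in> T. t - d \<notin> T}" by simp_all
  ultimately show ?thesis by linarith
qed

text \<open>From each start one steps up by \<open>d\<close> until leaving \<open>T\<close>, and
  stepping down from any element ends at a start. The enumeration \<open>base\<close> of the starts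
  is an input, so that each application fixes which chain is number 0.\<close>

lemma chain_decomposition:
  fixes T :: "int set" and base :: "nat \<Rightarrow> int"
  assumes fin: "finite T" and d: "d > 0"
    and inj: "inj_on base I" and starts: "base ` I = {t \<in> T. t - d \<notin> T}"
  shows "\<exists>len :: nat \<Rightarrow> int. (\<forall>c \<in> I. len c \<ge> 1 \<and> base c + len c * d \<notin> T) \<and>
    bij_betw (\<lambda>(c, i). base c + i * d) (SIGMA c:I. {0..<len c}) T"
proof -
  have "\<exists>l \<ge> 1. s + l * d \<notin> T \<and> (\<forall>i. 0 \<le> i \<and> i < l \<longrightarrow> s + i * d \<in> T)" if "s \<in> T" for s
  proof -
    define P where "P = (\<lambda>n. s + int n * d \<notin> T)"
    have "\<exists>n. P n"
    proof (rule ccontr)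
      assume "\<not> (\<exists>n. P n)"
      then have "range (\<lambda>n. s + int n * d) \<subseteq> T" by (auto simp: P_def)
      moreover have "inj (\<lambda>n. s + int n * d)" using d by (auto intro: injI)
      ultimately show False using fin finite_imageD finite_subset infinite_UNIV_nat by blast
    qed
    then obtain N where N: "P N" "\<And>n. n < N \<Longrightarrow> \<not> P n"
      by (metis exists_least_iff)
    have "N \<noteq> 0" using N(1) that by (auto simp: P_def intro: ccontr)
    moreover have "s + i * d \<in> T" if "0 \<le> i" "i < int N" for i
      using N(2)[of "nat i"] that by (simp add: P_def)
    ultimately show ?thesis
      using N(1) unfolding P_def by (intro exI[of _ "int N"]) simp
  qed
  then obtain l where l: "\<And>s. s \<in> T \<Longrightarrow> l s \<ge> 1 \<and> s + l s * d \<notin> T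
      \<and> (\<forall>i. 0 \<le> i \<and> i < l s \<longrightarrow> s + i * d \<in> T)"
    by metis
  define len where "len = (\<lambda>c. l (base c))"
  have baseT: "base c \<in> T" "base c - d \<notin> T" if "c \<in> I" for c
    using starts that by blast+
  have len: "len c \<ge> 1" "base c + len c * d \<notin> T"
    "\<And>i. 0 \<le> i \<Longrightarrow> i < len c \<Longrightarrow> base c + i * d \<in> T" if "c \<in> I" for c
    using l[OF baseT(1)[OF that]] by (auto simp: len_def)
  have cover: "\<exists>c \<in> I. \<exists>i. 0 \<le> i \<and> i < len c \<and> t = base c + i * d" if "t \<in> T" for t
    using that
  proof (induction "nat (t - Min T)" arbitrary: t rule: less_induct)
    case less
    show ?case
    proof (cases "t - d \<in> T")
      case False
      then obtain c where "c \<in> I" "t = base c" using starts less.prems by blast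
      then show ?thesis using len(1) by (intro bexI[of _ c] exI[of _ 0]) force+
    next
      case True
      then have "Min T \<le> t - d" using fin by simp
      then obtain c i where c: "c \<in> I" "0 \<le> i" "i < len c" "t - d = base c + i * d"
        using less.hyps[of "t - d"] True d by auto
      then have t: "t = base c + (i + 1) * d" by (simp add: algebra_simps)
      then have "i + 1 \<noteq> len c" using len(2) c less.prems by metis
      then show ?thesis using c t by (intro bexI[of _ c] exI[of _ "i + 1"]) auto
    qed
  qed
  \<comment> \<open>If \<open>i < j\<close>, stepping back from the common element along the chain
    of \<open>c'\<close> would meet \<open>base c - d\<close>, although \<open>base c\<close> is a
    start.\<close>
  have le: "i = j" if "c \<in> I" "c' \<in> I" "0 \<le> i" "j < len c'" "i \<le> j"
    "base c + i * d = base c' + j * d" for c c' i j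
  proof (rule ccontr)
    assume "i \<noteq> j"
    then have "base c' + (j - i - 1) * d \<in> T" using that by (intro len(3)) auto
    moreover have "base c' + (j - i - 1) * d = base c - d"
      using that(6) by (simp add: algebra_simps)
    ultimately show False using baseT(2) that by metis
  qed
  have "inj_on (\<lambda>(c, i). base c + i * d) (SIGMA c:I. {0..<len c})"
  proof (rule inj_onI, clarify)
    fix c c' :: nat and i j :: int
    assume a: "c \<in> I" "i \<in> {0..<len c}" "c' \<in> I" "j \<in> {0..<len c'}"
      "base c + i * d = base c' + j * d"
    then have "i = j" using le[of c c' i j] le[of c' c j i] by (cases "i \<le> j") auto
    then show "c = c' \<and> i = j" using a inj by (auto dest: inj_onD)
  qed
  moreover have "(\<lambda>(c, i). base c + i * d) ` (SIGMA c:I. {0..<len c}) = T"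
  proof
    show "T \<subseteq> (\<lambda>(c, i). base c + i * d) ` (SIGMA c:I. {0..<len c})"
    proof
      fix t assume "t \<in> T"
      then obtain c i where "c \<in> I" "0 \<le> i" "i < len c" "t = base c + i * d"
        using cover by blast
      then show "t \<in> (\<lambda>(c, i). base c + i * d) ` (SIGMA c:I. {0..<len c})"
        by (intro image_eqI[of _ _ "(c, i)"]) auto
    qed
  qed (use len(3) in auto)
  ultimately show ?thesis using len(1,2) unfolding bij_betw_def by blast
qed

locale three_chains =
  fixes T :: "int set" and d :: int and base len :: "nat \<Rightarrow> int"
  assumes d_pos: "d > 0"
    and bij: "bij_betw (\<lambda>(c, i). base c + i * d) (SIGMA c:{..<3}. {0..<len c}) T"
    and two_nonadjacent: "x \<in> T \<Longrightarrow> card {y \<in> T. x \<noteq> y \<and> \<bar>x - y\<bar> \<notin> T} = 2"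
begin

text \<open>Adjacency in \<open>H\<close> in chain coordinates. The range conditions are built in so
  that neighbour sets contain only genuine vertices and have the same size as in
  \<open>T\<close>.\<close>

definition adj :: "nat \<Rightarrow> int \<Rightarrow> nat \<Rightarrow> int \<Rightarrow> bool" where
  "adj c i c' j \<longleftrightarrow> (c < 3 \<and> 0 \<le> i \<and> i < len c) \<and> (c' < 3 \<and> 0 \<le> j \<and> j < len c') \<and>
     (c \<noteq> c' \<or> i \<noteq> j) \<and> \<bar>(base c + i * d) - (base c' + j * d)\<bar> \<notin> T"

lemma mem: "c < 3 \<Longrightarrow> 0 \<le> i \<Longrightarrow> i < len c \<Longrightarrow> base c + i * d \<in> T"
  using bij_betwE[OF bij] by force

lemma mem_cases:
  assumes "t \<in> T"
  obtains c i where "c < 3" "0 \<le> i" "i < len c" "t = base c + i * d"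
proof -
  have "t \<in> (\<lambda>(c, i). base c + i * d) ` (SIGMA c:{..<3}. {0..<len c})"
    using bij assms by (simp add: bij_betw_def)
  then show thesis using that by auto
qed

lemma card_T: "\<lbrakk>len 0 \<ge> 0; len 1 \<ge> 0; len 2 \<ge> 0\<rbrakk> \<Longrightarrow> int (card T) = len 0 + len 1 + len 2"
proof -
  have "card T = card (SIGMA c:{..<3::nat}. {0..<len c})"
    using bij by (simp add: bij_betw_same_card)
  also have "\<dots> = (\<Sum>c<3. nat (len c))" by (subst card_SigmaI) auto
  finally show "\<lbrakk>len 0 \<ge> 0; len 1 \<ge> 0; len 2 \<ge> 0\<rbrakk> \<Longrightarrow> ?thesis"
    by (simp add: numeral_3_eq_3 numeral_2_eq_2)
qed

sublocale chain_graph len adj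
proof
  fix c i c' j i' j'
  assume a: "adj c i c' j" "0 \<le> i'" "i' < len c" "0 \<le> j'" "j' < len c'" "j' - i' = j - i"
  have "i' * d - j' * d = i * d - j * d"
    using a(6) by (metis left_diff_distrib minus_diff_eq)
  then have "(base c + i' * d) - (base c' + j' * d) = (base c + i * d) - (base c' + j * d)"
    by linarith
  moreover have "c \<noteq> c' \<or> i' \<noteq> j'" using a by (auto simp: adj_def)
  ultimately show "adj c i' c' j'" using a unfolding adj_def by metis
next
  fix c :: nat and i :: int
  assume a: "c < 3" "0 \<le> i" "i < len c"
  let ?x = "base c + i * d"
  have inj: "inj_on (\<lambda>(c, i). base c + i * d) (SIGMA c:{..<3}. {0..<len c})"
    using bij by (simp add: bij_betw_def)
  have img: "(\<lambda>(c, i). base c + i * d) ` {(c', j). adj c i c' j} = {y \<in> T. ?x \<noteq> y \<and> \<bar>?x - y\<bar> \<notin> T}"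
    (is "?f ` ?A = ?B")
  proof (intro equalityI subsetI)
    fix y assume "y \<in> ?f ` ?A"
    then obtain c' j where y: "adj c i c' j" "y = base c' + j * d" by auto
    moreover from this have "?x \<noteq> y"
      using inj_onD[OF inj, of "(c, i)" "(c', j)"] by (auto simp: adj_def)
    ultimately show "y \<in> ?B" using mem by (auto simp: adj_def)
  next
    fix y assume y: "y \<in> ?B"
    then obtain c' j where "c' < 3" "0 \<le> j" "j < len c'" "y = base c' + j * d"
      using mem_cases by blast
    then show "y \<in> ?f ` ?A"
      using y a by (intro image_eqI[of _ _ "(c', j)"]) (auto simp: adj_def)
  qed
  have "inj_on ?f ?A"
    using inj by (rule inj_on_subset) (auto simp: adj_def)
  then have "card ?A = card ?B"
    unfolding img[symmetric] by (rule card_image[symmetric])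
  then show "card ?A = 2" using two_nonadjacent[OF mem[OF a]] by simp
qed (auto simp: adj_def abs_minus_commute)

lemma adj_same_chain:
  "adj c i c j \<longleftrightarrow> c < 3 \<and> 0 \<le> i \<and> i < len c \<and> 0 \<le> j \<and> j < len c \<and> i \<noteq> j \<and> \<bar>i - j\<bar> * d \<notin> T"
proof -
  have "\<bar>(base c + i * d) - (base c + j * d)\<bar> = \<bar>i - j\<bar> * d"
    using d_pos by (simp add: left_diff_distrib[symmetric] abs_mult)
  then show ?thesis by (auto simp: adj_def)
qed

end

section \<open>Signatures that are sets of nonzero integers\<close>

text \<open>Neighbours are at distance \<open>\<alpha>\<close> or \<open>\<beta>\<close>. The
  vertices \<open>\<beta> - \<alpha>\<close> and \<open>2 * \<alpha>\<close> each have a deleted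
  point among their candidates, which forces the remaining candidates into \<open>U\<close>. Then
  \<open>\<alpha> + 1\<close> has three neighbours unless \<open>\<beta> = 2 * \<alpha> + 1\<close>,
  and in that case \<open>\<beta> + 1\<close> has three.\<close>

lemma interval_minus_two_not_2_regular:
  fixes \<alpha> \<beta> m :: int
  defines "U \<equiv> {1..m} - {\<alpha>, \<beta>}"
  assumes ab: "3 \<le> \<alpha>" "\<alpha> + 3 \<le> \<beta>" "\<beta> + 2 \<le> m" "\<beta> \<noteq> 2 * \<alpha>"
    and deg: "\<And>x. x \<in> U \<Longrightarrow> card {y \<in> U. x \<noteq> y \<and> \<bar>x - y\<bar> \<notin> U} = 2"
  shows False
proof -
  let ?N = "\<lambda>x. {y \<in> U. x \<noteq> y \<and> \<bar>x - y\<bar> \<notin> U}"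
  have N: "y \<in> ?N x \<longleftrightarrow> y \<in> U \<and> (\<bar>x - y\<bar> = \<alpha> \<or> \<bar>x - y\<bar> = \<beta>)" if "x \<in> U" for x y
    using that ab by (auto simp: U_def)
  have ba: "\<beta> - \<alpha> \<in> U" using ab by (auto simp: U_def)
  have "\<beta> > 2 * \<alpha>"
  proof -
    obtain y where y: "y \<in> ?N (\<beta> - \<alpha>)" "y \<noteq> 2 * \<beta> - \<alpha>"
      using other_in_pair[OF deg[OF ba]] by blast
    then show ?thesis using ab unfolding N[OF ba] U_def by auto
  qed
  then have "2 * \<alpha> \<in> U" using ab by (auto simp: U_def)
  have a2: "2 * \<alpha> + \<beta> \<le> m"
  proof -
    obtain y where y: "y \<in> ?N (2 * \<alpha>)" "y \<noteq> 3 * \<alpha>"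
      using other_in_pair[OF deg[OF \<open>2 * \<alpha> \<in> U\<close>]] by blast
    then show ?thesis using ab \<open>\<beta> > 2 * \<alpha>\<close> unfolding N[OF \<open>2 * \<alpha> \<in> U\<close>] U_def by auto
  qed
  have a1: "\<alpha> + 1 \<in> U" using ab by (auto simp: U_def)
  have b: "\<beta> = 2 * \<alpha> + 1"
  proof (rule ccontr)
    assume "\<beta> \<noteq> 2 * \<alpha> + 1"
    then have "1 \<in> ?N (\<alpha> + 1)" "2 * \<alpha> + 1 \<in> ?N (\<alpha> + 1)" "\<alpha> + 1 + \<beta> \<in> ?N (\<alpha> + 1)"
      unfolding N[OF a1] using ab a2 by (auto simp: U_def)
    from three_in_pair[OF deg[OF a1] this] show False using ab by linarith
  qed
  have b1: "\<beta> + 1 \<in> U" using ab by (auto simp: U_def)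
  have "1 \<in> ?N (\<beta> + 1)" "\<beta> + 1 - \<alpha> \<in> ?N (\<beta> + 1)" "\<beta> + 1 + \<alpha> \<in> ?N (\<beta> + 1)"
    unfolding N[OF b1] using ab a2 b by (auto simp: U_def)
  from three_in_pair[OF deg[OF b1] this] show False using ab by linarith
qed

text \<open>The chains with difference \<open>d = Min T\<close> start at \<open>d\<close> and at its
  two neighbours \<open>a < b\<close>. If any chain is a singleton, the chain lemmas apply;
  otherwise the starts are determined and \<open>T\<close> is a dilated interval with two points
  deleted.\<close>

lemma positive_set_not_2_regular:
  fixes T :: "int set"
  assumes fin: "finite T" and card: "card T \<ge> 8" "even (card T)"
    and pos: "\<And>x. x \<in> T \<Longrightarrow> x > 0"
    and deg: "\<And>x. x \<in> T \<Longrightarrow> card {y \<in> T. x \<noteq> y \<and> \<bar>x - y\<bar> \<notin> T} = 2"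
    and triangle_free: "\<And>x y z. \<lbrakk>x \<in> T; y \<in> T; z \<in> T; x \<noteq> y; y \<noteq> z; x \<noteq> z;
      \<bar>x - y\<bar> \<notin> T; \<bar>x - z\<bar> \<notin> T\<rbrakk> \<Longrightarrow> \<bar>y - z\<bar> \<in> T"
  shows False
proof -
  define d where "d = Min T"
  have "T \<noteq> {}" using card by auto
  then have dT: "d \<in> T" and dmin: "\<And>x. x \<in> T \<Longrightarrow> d \<le> x" using fin by (auto simp: d_def)
  have d: "d > 0" using dT pos by simp
  obtain a b where ab: "{y \<in> T. d \<noteq> y \<and> \<bar>d - y\<bar> \<notin> T} = {a, b}" "a < b"
  proof -
    obtain x y where "{y \<in> T. d \<noteq> y \<and> \<bar>d - y\<bar> \<notin> T} = {x, y}" "x \<noteq> y"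
      using deg[OF dT] by (auto simp: card_2_iff)
    then show thesis using that[of x y] that[of y x] by (cases "x < y") (auto simp: insert_commute)
  qed
  have "a \<in> {y \<in> T. d \<noteq> y \<and> \<bar>d - y\<bar> \<notin> T}" "b \<in> {y \<in> T. d \<noteq> y \<and> \<bar>d - y\<bar> \<notin> T}"
    using ab by auto
  then have abT: "a \<in> T" "b \<in> T" "\<bar>d - a\<bar> \<notin> T" "\<bar>d - b\<bar> \<notin> T" "d \<noteq> a" "d \<noteq> b" by auto
  have dab: "d < a" "d < b" using abT dmin[of a] dmin[of b] by auto
  define base where "base = (\<lambda>c::nat. if c = 0 then d else if c = 1 then a else b)"
  have base: "base 0 = d" "base 1 = a" "base 2 = b" by (simp_all add: base_def)
  have "base ` {..<3} = {d, a, b}"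
    by (simp add: base_def numeral_3_eq_3 lessThan_Suc insert_commute)
  \<comment> \<open>Since \<open>d\<close> is the minimum, \<open>t - d\<close> is the distance from
    \<open>d\<close> to \<open>t\<close>; so the starts other than \<open>d\<close> are the
    neighbours of \<open>d\<close>.\<close>
  moreover have "{t \<in> T. t - d \<notin> T} = {d, a, b}"
  proof -
    have "t - d = \<bar>d - t\<bar>" if "t \<in> T" for t using dmin[OF that] by simp
    moreover have "0 \<notin> T" using pos by blast
    ultimately have "{t \<in> T. t - d \<notin> T} = insert d {y \<in> T. d \<noteq> y \<and> \<bar>d - y\<bar> \<notin> T}"
      using dT by auto
    then show ?thesis using ab by auto
  qed
  ultimately have starts: "base ` {..<3} = {t \<in> T. t - d \<notin> T}" by simp
  have inj: "inj_on base {..<3}"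
    using dab ab(2) by (auto simp: inj_on_def base_def)
  obtain len where "\<forall>c \<in> {..<3}. len c \<ge> 1 \<and> base c + len c * d \<notin> T"
    and bij: "bij_betw (\<lambda>(c, i). base c + i * d) (SIGMA c:{..<3}. {0..<len c}) T"
    using chain_decomposition[OF fin d inj starts] by blast
  then have len: "\<And>c. c < 3 \<Longrightarrow> len c \<ge> 1" "\<And>c. c < 3 \<Longrightarrow> base c + len c * d \<notin> T"
    by auto
  interpret three_chains T d base len
    using d bij deg by unfold_locales
  have len1: "len 0 \<ge> 1" "len 1 \<ge> 1" "len 2 \<ge> 1" using len(1) by simp_all
  have cardT: "int (card T) = len 0 + len 1 + len 2" using card_T len1 by simp
  have len8: "len 0 + len 1 + len 2 \<ge> 8" "even (len 0 + len 1 + len 2)"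
    using card unfolding cardT[symmetric] by simp_all
  have mult: "i * d \<in> T" if "1 \<le> i" "i \<le> len 0" for i
    using mem[of 0 "i - 1"] that base by (simp add: algebra_simps)
  have mult_end: "(len 0 + 1) * d \<notin> T"
    using len(2)[of 0] base by (simp add: algebra_simps)
  have start: "adj 0 0 1 0" "adj 0 0 2 0"
    using len1 base abT by (auto simp: adj_def)
  have near: "\<bar>i - j\<bar> > len 0" if "adj c i c j" for c i j
    using that mult[of "\<bar>i - j\<bar>"] unfolding adj_same_chain by force
  (* With s = base c: |s - 2 d| is in T but s - d is not, so s - 2 d is the end of a chain. *)
  have gap: "\<exists>c' < 3. base c = base c' + (len c' + 1) * d \<and> base c' < base c"
    if c: "c \<in> {1, 2}" "len 0 \<ge> 2" "\<not> adj 0 1 c 0" for c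
  proof -
    have s: "base c \<in> T" "base c > d" "base c - d \<notin> T"
      using c abT dab base by (auto simp: abs_if split: if_splits)
    have "\<bar>2 * d - base c\<bar> \<in> T"
      using c len1 base by (auto simp: adj_def)
    moreover have "base c \<noteq> 2 * d" using s dT by auto
    moreover have "\<not> base c < 2 * d" using calculation dmin[of "\<bar>2 * d - base c\<bar>"] s by auto
    ultimately have y: "base c - 2 * d \<in> T" by (simp add: abs_if split: if_splits)
    obtain c' i where ci: "c' < 3" "0 \<le> i" "i < len c'" "base c - 2 * d = base c' + i * d"
      using mem_cases[OF y] by blast
    have "i + 1 = len c'"
    proof (rule ccontr)
      assume "i + 1 \<noteq> len c'"
      then have "base c' + (i + 1) * d \<in> T" using ci by (intro mem) auto
      moreover have "base c' + (i + 1) * d = base c - d" using ci(4) by (simp add: algebra_simps)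
      ultimately show False using s by simp
    qed
    then have l: "len c' = i + 1" by simp
    have "i * d \<ge> 0" using ci d by simp
    moreover have "base c = base c' + (len c' + 1) * d"
      using ci(4) by (simp add: l algebra_simps)
    ultimately show ?thesis using ci d by (intro exI[of _ c']) simp
  qed
  show False
  proof (cases "len 0 = 1")
    case True
    have "2 * d \<notin> T" using mult_end True by simp
    then have two: "adj c i c (i + 2)" if "c \<in> {1, 2}" "0 \<le> i" "i + 2 < len c" for c i
      using that by (auto simp: adj_same_chain)
    have "len 1 + len 2 \<ge> 7" "odd (len 1 + len 2)" using True len8 by auto
    from first_chain_singleton[OF True len1(2,3) this start two] show False .
  next
    case False
    then have k2: "len 0 \<ge> 2" using len1 by simp
    \<comment> \<open>By \<open>gap\<close>, \<open>base g\<close> lies \<open>2 * d\<close> above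
      the end of chain 0 or of \<open>f\<close>. Its distance from \<open>len 0 * d\<close> is then
      \<open>2 * d\<close> or \<open>base f\<close>, both in \<open>T\<close>, against the edge
      between them.\<close>
    have no_singleton: False if fg: "{f, g} = {1, 2}" and "len g = 1" for f g
    proof -
      have ids: "f \<in> {1, 2}" "g \<in> {1, 2}" "f \<noteq> g"
        using fg by (auto simp: doubleton_eq_iff)
      have lf: "len f \<ge> 1" "len 0 + len f \<ge> 7" "odd (len 0 + len f)"
        using ids len1 len8 that(2) by auto
      have "adj 0 0 f 0" "adj 0 0 g 0" using ids start by auto
      then have *: "\<not> adj 0 1 g 0" "adj 0 (len 0 - 1) g 0" "len f = len 0 - 1"
        using other_chain_singleton[OF fg k2 that(2) lf _ _ near] by auto
      from gap[OF ids(2) k2 *(1)] obtain c' where c': "c' < 3"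
        "base g = base c' + (len c' + 1) * d" "base c' < base g" by blast
      have "\<bar>len 0 * d - base g\<bar> \<notin> T"
        using *(2) base by (simp add: adj_def algebra_simps)
      moreover have "\<bar>len 0 * d - base g\<bar> = 2 * d" if "c' = 0"
        using c'(2) that base d by (simp add: algebra_simps)
      moreover have "2 * d \<in> T" using mult k2 by simp
      moreover have f: "base f \<in> T" "base f > 0" using ids abT base pos by auto
      moreover have "\<bar>len 0 * d - base g\<bar> = base f" if "c' = f"
        using c'(2) that *(3) f by (simp add: algebra_simps)
      moreover have "c' \<noteq> g" using c'(3) by auto
      then have "c' = 0 \<or> c' = f" using fg c'(1) by (auto simp: doubleton_eq_iff)
      ultimately show False by metis
    qed
    have "len 1 \<noteq> 1" "len 2 \<noteq> 1"
      using no_singleton[of 1 2] no_singleton[of 2 1] by (auto simp: insert_commute)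
    then have l2: "len 1 \<ge> 2" "len 2 \<ge> 2"
      using len1 by linarith+
    \<comment> \<open>These two edges use up the degree of \<open>(0, 1)\<close>, so
      \<open>gap\<close> applies to both chains 1 and 2.\<close>
    have "adj 0 1 1 1" "adj 0 1 2 1"
      using adj_translate[OF start(1), of 1 1] adj_translate[OF start(2), of 1 1] l2 k2 by auto
    then have not1: "\<not> adj 0 1 1 0" "\<not> adj 0 1 2 0"
      using adj_full[of 0 1 1 1 2 1 1 0] adj_full[of 0 1 1 1 2 1 2 0] by auto
    have c3: "c = 0 \<or> c = 1 \<or> c = 2" if "c < 3" for c :: nat using that by linarith
    have a: "a = (len 0 + 2) * d"
    proof -
      obtain c where c: "c < 3" "base 1 = base c + (len c + 1) * d" "base c < base 1"
        using gap[of 1] k2 not1 by auto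
      then have "c = 0" using c3[of c] base ab(2) by auto
      then show ?thesis using c(2) base by (simp add: algebra_simps)
    qed
    have b: "b = a + (len 1 + 1) * d"
    proof -
      obtain c where c: "c < 3" "base 2 = base c + (len c + 1) * d" "base c < base 2"
        using gap[of 2] k2 not1 by auto
      have "c \<noteq> 0"
      proof
        assume "c = 0"
        then have "b = a" using c(2) base a by (simp add: algebra_simps)
        then show False using ab(2) by simp
      qed
      then have "c = 1" using c3[of c] c by auto
      then show ?thesis using c(2) base by simp
    qed
    \<comment> \<open>The chains now follow one another with one multiple of \<open>d\<close>
      missing in between: \<open>\<alpha>\<close> and \<open>\<beta>\<close> are the missing
      factors, \<open>m\<close> the largest one present.\<close>
    define \<alpha> \<beta> m where "\<alpha> = len 0 + 1" and "\<beta> = len 0 + len 1 + 2"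
      and "m = len 0 + len 1 + len 2 + 2"
    define U where "U = {1..m} - {\<alpha>, \<beta>}"
    have T: "T = (\<lambda>x. x * d) ` U"
    proof (intro equalityI subsetI)
      fix t assume "t \<in> T"
      then obtain c i where ci: "c < 3" "0 \<le> i" "i < len c" "t = base c + i * d"
        using mem_cases by blast
      consider "c = 0" | "c = 1" | "c = 2" using ci c3 by blast
      then show "t \<in> (\<lambda>x. x * d) ` U"
      proof cases
        case 1
        then show ?thesis using ci base len1 l2
          by (intro image_eqI[of _ _ "i + 1"]) (auto simp: U_def \<alpha>_def \<beta>_def m_def algebra_simps)
      next
        case 2
        then show ?thesis using ci base len1 l2 a
          by (intro image_eqI[of _ _ "\<alpha> + 1 + i"]) (auto simp: U_def \<alpha>_def \<beta>_def m_def algebra_simps)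
      next
        case 3
        then show ?thesis using ci base len1 l2 a b
          by (intro image_eqI[of _ _ "\<beta> + 1 + i"]) (auto simp: U_def \<alpha>_def \<beta>_def m_def algebra_simps)
      qed
    next
      fix t assume "t \<in> (\<lambda>x. x * d) ` U"
      then obtain x where x: "x \<in> U" "t = x * d" by blast
      then consider "1 \<le> x" "x < \<alpha>" | "\<alpha> < x" "x < \<beta>" | "\<beta> < x" "x \<le> m"
        by (force simp: U_def)
      then show "t \<in> T"
      proof cases
        case 1
        then show ?thesis using mult x by (simp add: \<alpha>_def)
      next
        case 2
        then show ?thesis using mem[of 1 "x - \<alpha> - 1"] x a base
          by (simp add: \<alpha>_def \<beta>_def algebra_simps)
      next
        case 3
        then show ?thesis using mem[of 2 "x - \<beta> - 1"] x a b base
          by (simp add: m_def \<beta>_def algebra_simps)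
      qed
    qed
    have TU: "x * d \<in> T \<longleftrightarrow> x \<in> U" for x
      using d by (auto simp: T)
    \<comment> \<open>Otherwise \<open>d\<close>, \<open>a\<close>, \<open>b\<close> would be a
      triangle in \<open>H\<close>. This is what excludes
      \<open>\<beta> = 2 * \<alpha>\<close>.\<close>
    have "\<bar>a - b\<bar> \<in> T"
      using triangle_free[of d a b] dT abT ab by auto
    moreover have "\<bar>a - b\<bar> = (\<beta> - \<alpha>) * d"
      using ab(2) b by (simp add: \<alpha>_def \<beta>_def algebra_simps)
    ultimately have "\<beta> \<noteq> 2 * \<alpha>"
      using TU by (auto simp: U_def)
    moreover have "card {y \<in> U. x \<noteq> y \<and> \<bar>x - y\<bar> \<notin> U} = 2" if x: "x \<in> U" for x
    proof -
      have "\<bar>x * d - y * d\<bar> = \<bar>x - y\<bar> * d" for y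
        using d by (simp add: left_diff_distrib[symmetric] abs_mult)
      then have "{y \<in> T. x * d \<noteq> y \<and> \<bar>x * d - y\<bar> \<notin> T}
          = (\<lambda>x. x * d) ` {y \<in> U. x \<noteq> y \<and> \<bar>x - y\<bar> \<notin> U}"
        using d TU by (subst (1) T) auto
      moreover have "inj_on (\<lambda>x. x * d) A" for A using d by (auto intro: inj_onI)
      ultimately show ?thesis using deg[of "x * d"] x TU by (simp add: card_image)
    qed
    ultimately show False
      using interval_minus_two_not_2_regular[of \<alpha> \<beta> m] k2 l2
      unfolding U_def \<alpha>_def \<beta>_def m_def by auto
  qed
qed

text \<open>The chain ends for difference \<open>L\<close> are \<open>- L\<close>, because 0 is
  absent, and its two neighbours. So there are three starts, among them \<open>- L\<close> and
  \<open>L\<close>, and the chain \<open>{- L}\<close> is the apex of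
  \<open>apex_with_two_chains\<close>.\<close>

lemma negative_min_set_not_2_regular:
  fixes T :: "int set"
  assumes fin: "finite T" and card: "card T \<ge> 8" "even (card T)"
    and L: "L > 0" "L \<in> T" "- L \<in> T" and min: "\<And>x. x \<in> T \<Longrightarrow> - L \<le> x"
    and zero: "0 \<notin> T"
    and deg: "\<And>x. x \<in> T \<Longrightarrow> card {y \<in> T. x \<noteq> y \<and> \<bar>x - y\<bar> \<notin> T} = 2"
  shows False
proof -
  have "{t \<in> T. t + L \<notin> T} = insert (- L) {y \<in> T. - L \<noteq> y \<and> \<bar>- L - y\<bar> \<notin> T}"
  proof -
    have "\<bar>- L - y\<bar> = y + L" if "y \<in> T" for y using min[OF that] by simp
    then show ?thesis using L zero by auto
  qed
  then have "card {t \<in> T. t + L \<notin> T} = 3"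
    using deg[OF L(3)] fin by simp
  then have c3: "card {t \<in> T. t - L \<notin> T} = 3"
    using card_chain_starts[OF fin] by simp
  have st: "- L \<in> {t \<in> T. t - L \<notin> T}" "L \<in> {t \<in> T. t - L \<notin> T}"
    using L zero min[of "- L - L"] by auto
  have "card ({t \<in> T. t - L \<notin> T} - {- L, L}) = 1"
    using c3 st L fin by (subst card_Diff_subset) auto
  then obtain q where "{t \<in> T. t - L \<notin> T} - {- L, L} = {q}" by (auto simp: card_1_singleton_iff)
  then have q: "{t \<in> T. t - L \<notin> T} = {- L, L, q}" "q \<noteq> L" "q \<noteq> - L" using st by blast+
  have qT: "q \<in> T" using q(1) by blast
  define base where "base = (\<lambda>c::nat. if c = 0 then - L else if c = 1 then L else q)"
  have base: "base 0 = - L" "base 1 = L" "base 2 = q" by (simp_all add: base_def)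
  have starts: "base ` {..<3} = {t \<in> T. t - L \<notin> T}" unfolding q(1)
    by (simp add: base_def numeral_3_eq_3 lessThan_Suc insert_commute)
  have inj: "inj_on base {..<3}"
    using q(2,3) L by (auto simp: inj_on_def base_def)
  obtain len where "\<forall>c \<in> {..<3}. len c \<ge> 1 \<and> base c + len c * L \<notin> T"
    and bij: "bij_betw (\<lambda>(c, i). base c + i * L) (SIGMA c:{..<3}. {0..<len c}) T"
    using chain_decomposition[OF fin L(1) inj starts] by blast
  then have len: "\<And>c. c < 3 \<Longrightarrow> len c \<ge> 1" "\<And>c. c < 3 \<Longrightarrow> base c + len c * L \<notin> T"
    by auto
  interpret three_chains T L base len
    using L bij deg by unfold_locales
  have len1: "len 0 \<ge> 1" "len 1 \<ge> 1" "len 2 \<ge> 1" using len(1) by simp_all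
  have len0: "len 0 = 1"
    using mem[of 0 1] len1 zero base by force
  have cardT: "int (card T) = len 0 + len 1 + len 2" using card_T len1 by simp
  have len8: "len 0 + len 1 + len 2 \<ge> 8" "even (len 0 + len 1 + len 2)"
    using card unfolding cardT[symmetric] by simp_all
  have mult: "i * L \<in> T" if "1 \<le> i" "i \<le> len 1" for i
    using mem[of 1 "i - 1"] that base by (simp add: algebra_simps)
  have mult_end: "(len 1 + 1) * L \<notin> T"
    using len(2)[of 1] base by (simp add: algebra_simps)
  \<comment> \<open>The distance from \<open>- L\<close> to the last element of a chain is the value
    one step beyond that chain, hence not in \<open>T\<close>. This yields both apex edges.\<close>
  have "- L - (L + (len 1 - 1) * L) = - ((len 1 + 1) * L)"
    by (simp add: algebra_simps)
  then have "\<bar>- L - (L + (len 1 - 1) * L)\<bar> = (len 1 + 1) * L"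
    using L len1 by simp
  then have e1: "adj 0 0 1 (len 1 - 1)"
    using len1 len0 mult_end base by (simp add: adj_def)
  have "len 2 * L \<ge> L" using L len1 by simp
  then have "\<bar>- L - (q + (len 2 - 1) * L)\<bar> = q + len 2 * L"
    using min[OF qT] by (simp add: algebra_simps abs_if)
  then have e2: "adj 0 0 2 (len 2 - 1)"
    using len1 len0 len(2)[of 2] base by (simp add: adj_def)
  have "\<not> adj 1 i 1 j" for i j
    using mult[of "\<bar>i - j\<bar>"] unfolding adj_same_chain by linarith
  moreover have "adj 2 i 2 (i + 2)" if "len 1 = 1" "0 \<le> i" "i + 2 < len 2" for i
    using that mult_end by (simp add: adj_same_chain)
  ultimately show False
    using apex_with_two_chains[of 1 2] len0 len1 len8 e1 e2 by auto
qed

section \<open>Multisets of integers\<close>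

lemma finite_occurrences: "finite (occurrences S)"
proof -
  have "occurrences S = (SIGMA s:set_mset S. {..<count S s})"
    by (auto simp: occurrences_def simp flip: count_greater_zero_iff)
  then show ?thesis by simp
qed

lemma occurrence_0: "s \<in># S \<Longrightarrow> (s, 0) \<in> occurrences S"
  by (simp add: occurrences_def)

lemma fst_occurrences: "fst ` occurrences S = set_mset S"
proof (intro equalityI subsetI)
  fix s assume "s \<in> fst ` occurrences S"
  then obtain i where "i < count S s" by (auto simp: occurrences_def)
  then have "count S s > 0" by linarith
  then show "s \<in># S" by (simp only: count_greater_zero_iff)
qed (use occurrence_0 in force)

text \<open>The set \<open>C\<close> marks the occurrences placed on one of the cycles.
  Disconnectedness of \<open>H\<close> is expressed by \<open>separated\<close>, \<open>C_ne\<close>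
  and \<open>C_ne_UNIV\<close>.\<close>

locale signature_of_two_cycles_complement =
  fixes S :: "int multiset" and C :: "(int \<times> nat) set"
  assumes two_nonadjacent: "p \<in> occurrences S \<Longrightarrow>
      card {q \<in> occurrences S. p \<noteq> q \<and> \<bar>fst p - fst q\<bar> \<notin># S} = 2"
    and triangle_free: "\<lbrakk>p \<in> occurrences S; q \<in> occurrences S; r \<in> occurrences S;
      p \<noteq> q; q \<noteq> r; p \<noteq> r; \<bar>fst p - fst q\<bar> \<notin># S; \<bar>fst p - fst r\<bar> \<notin># S\<rbrakk>
      \<Longrightarrow> \<bar>fst q - fst r\<bar> \<in># S"
    and separated: "\<lbrakk>p \<in> occurrences S; q \<in> occurrences S; p \<noteq> q; \<bar>fst p - fst q\<bar> \<notin># S\<rbrakk>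
      \<Longrightarrow> p \<in> C \<longleftrightarrow> q \<in> C"
    and C_ne: "\<exists>p \<in> occurrences S. p \<in> C"
    and C_ne_UNIV: "\<exists>p \<in> occurrences S. p \<notin> C"
    and card_even: "even (card (occurrences S))"
    and card_ge_8: "card (occurrences S) \<ge> 8"
begin

abbreviation T :: "int set" where "T \<equiv> set_mset S"

abbreviation nonadj :: "int \<times> nat \<Rightarrow> (int \<times> nat) set" where
  "nonadj p \<equiv> {q \<in> occurrences S. p \<noteq> q \<and> \<bar>fst p - fst q\<bar> \<notin> T}"

lemma fst_mem: "p \<in> occurrences S \<Longrightarrow> fst p \<in> T"
  using fst_occurrences[of S] by blast

lemma T_ne: "T \<noteq> {}"
  using C_ne fst_mem by blast

section \<open>Excluding zero and repeated elements\<close>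

text \<open>Otherwise every occurrence is linked in \<open>H\<close> to \<open>(w, 0)\<close> and
  lies on the same side of \<open>C\<close>.\<close>

lemma neg_Min_mem:
  assumes "Min T < 0" "t \<in> T" "t \<noteq> Min T"
  shows "- Min T \<in> T"
proof (rule ccontr)
  assume L: "- Min T \<notin> T"
  define w where "w = Min T"
  have w: "w \<in> T" "\<And>x. x \<in> T \<Longrightarrow> w \<le> x" using T_ne by (auto simp: w_def)
  note w0 = occurrence_0[OF w(1)]
  \<comment> \<open>Induction from the maximum downwards: either \<open>p\<close> is joined to
    \<open>w\<close> directly, or it is joined to the larger element \<open>fst p - w\<close>, at
    the absent distance \<open>- w\<close>.\<close>
  have *: "p \<in> C \<longleftrightarrow> (w, 0) \<in> C" if "p \<in> occurrences S" "fst p \<noteq> w" for p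
    using that
  proof (induction "nat (Max T - fst p)" arbitrary: p rule: less_induct)
    case less
    have p: "fst p \<in> T" using less.prems fst_mem by blast
    then have "w < fst p" using w(2)[OF p] less.prems by linarith
    show ?case
    proof (cases "fst p - w \<in> T")
      case True
      then have "fst p - w \<le> Max T" by simp
      then have "(fst p - w, 0) \<in> C \<longleftrightarrow> (w, 0) \<in> C"
        using less.hyps[of "(fst p - w, 0)"] occurrence_0[OF True] assms(1) \<open>w < fst p\<close>
        by (auto simp: w_def)
      moreover have "p \<in> C \<longleftrightarrow> (fst p - w, 0) \<in> C"
        using separated[OF less.prems(1) occurrence_0[OF True]] L assms(1)
        by (cases p) (auto simp: w_def)
      ultimately show ?thesis by simp
    next
      case False
      then show ?thesis
        using separated[OF less.prems(1) w0] less.prems \<open>w < fst p\<close> by (cases p) auto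
    qed
  qed
  define M where "M = Max T"
  have M: "M \<in> T" "\<And>x. x \<in> T \<Longrightarrow> x \<le> M"
    using T_ne by (auto simp: M_def)
  have "M \<noteq> w" using M(2)[OF assms(2)] w(2)[OF assms(2)] assms(3) by (auto simp: w_def)
  have "p \<in> C \<longleftrightarrow> (w, 0) \<in> C" if p: "p \<in> occurrences S" for p
  proof (cases "fst p = w")
    case True
    \<comment> \<open>Copies of \<open>w\<close> are linked through the maximum, because
      \<open>M - w\<close> exceeds it.\<close>
    have "M - w \<notin> T" using M(2)[of "M - w"] assms(1) by (auto simp: w_def)
    then have "(M, 0) \<in> C \<longleftrightarrow> p \<in> C"
      using separated[OF p occurrence_0[OF M(1)]] True \<open>M \<noteq> w\<close> w(2)[OF M(1)] by (cases p) auto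
    then show ?thesis using *[of "(M, 0)"] occurrence_0[OF M(1)] \<open>M \<noteq> w\<close> by simp
  qed (use * p in blast)
  then show False using C_ne C_ne_UNIV by blast
qed

text \<open>A neighbour of 0 in \<open>H\<close> must be negative with its absolute value absent.
  Few chains exist when 0 is present, so the two neighbours \<open>p\<close>, \<open>q\<close> have
  equal values; tracing these values through \<open>w\<close> and \<open>L\<close> produces one
  start too many.\<close>

lemma zero_notin: "0 \<notin> T"
proof
  assume zero: "0 \<in> T"
  define w L where "w = Min T" and "L = - w"
  have w: "w \<in> T" "\<And>x. x \<in> T \<Longrightarrow> w \<le> x" using T_ne by (auto simp: w_def)
  have z0: "(0, 0) \<in> occurrences S" using occurrence_0[OF zero] .
  obtain p q where pq: "nonadj (0, 0) = {p, q}" "p \<noteq> q"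
    using two_nonadjacent[OF z0] by (auto simp: card_2_iff)
  have neg: "r \<in> occurrences S \<and> fst r < 0 \<and> - fst r \<notin> T" if "r \<in> {p, q}" for r
  proof -
    have "r \<in> nonadj (0, 0)" using that pq by simp
    then show ?thesis using fst_mem[of r] zero
      by (cases "fst r = 0") (auto simp: abs_if split: if_splits)
  qed
  have "w \<le> fst p" "fst p < 0" using neg[of p] w(2) fst_mem[of p] by auto
  then have "w < 0" by simp
  then have L: "L > 0" "L \<in> T" using neg_Min_mem[of 0] zero by (auto simp: L_def w_def)
  have neg': "w < fst r" "fst r - L \<notin> T" if "r \<in> {p, q}" for r
  proof -
    have "fst r \<noteq> w" using neg[OF that] L L_def by auto
    moreover have "w \<le> fst r" using w(2) neg[OF that] fst_mem by blast
    ultimately show "w < fst r" by simp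
    show "fst r - L \<notin> T" using w(2)[of "fst r - L"] neg[OF that] by (auto simp: L_def)
  qed
  note w0 = occurrence_0[OF w(1)]
  \<comment> \<open>As \<open>w + L = 0\<close> is present, \<open>w\<close> is not an end, so there
    are at most two ends, and hence at most two starts.\<close>
  have "{t \<in> T. t + L \<notin> T} \<subseteq> fst ` nonadj (w, 0)"
  proof
    fix t assume t: "t \<in> {t \<in> T. t + L \<notin> T}"
    then have "t \<noteq> w" "w \<le> t" using zero w by (auto simp: L_def)
    then have "(t, 0) \<in> nonadj (w, 0)" using t occurrence_0[of t S] by (auto simp: L_def)
    then show "t \<in> fst ` nonadj (w, 0)" by force
  qed
  then have "card {t \<in> T. t + L \<notin> T} \<le> card (nonadj (w, 0))"
    using finite_occurrences[of S] by (intro surj_card_le) auto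
  then have starts: "card {t \<in> T. t - L \<notin> T} \<le> 2"
    using two_nonadjacent[OF w0] card_chain_starts[of T L] by simp
  have no3: "x = y \<or> x = z \<or> y = z" if "{x, y, z} \<subseteq> {t \<in> T. t - L \<notin> T}" for x y z
  proof (rule ccontr)
    assume "\<not> ?thesis"
    then have "card {x, y, z} = 3" by simp
    moreover have "card {x, y, z} \<le> card {t \<in> T. t - L \<notin> T}"
      using that by (intro card_mono) auto
    ultimately show False using starts by simp
  qed
  have wst: "w \<in> {t \<in> T. t - L \<notin> T}" using w(1) w(2)[of "w - L"] L by auto
  have pst: "fst p \<in> {t \<in> T. t - L \<notin> T}" "fst q \<in> {t \<in> T. t - L \<notin> T}"
    using neg neg' fst_mem by auto
  have wpq: "w < fst p" "w < fst q" using neg' by auto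
  then have eq: "fst q = fst p" using no3[of w "fst p" "fst q"] wst pst by simp
  have pL: "fst p + L \<in> T"
  proof (rule ccontr)
    assume a: "fst p + L \<notin> T"
    define M where "M = Max T"
    have "M \<in> T" "\<And>x. x \<in> T \<Longrightarrow> x \<le> M" using T_ne by (auto simp: M_def)
    then have M: "M \<in> T" "M \<ge> 0" "M - w \<notin> T"
      using zero \<open>w < 0\<close> by force+
    have "p \<in> nonadj (w, 0)" "q \<in> nonadj (w, 0)"
      using a neg[of p] neg[of q] wpq eq by (auto simp: L_def)
    moreover have "(M, 0) \<in> nonadj (w, 0)"
      using M \<open>w < 0\<close> by (auto simp: occurrence_0)
    ultimately show False
      using three_in_pair[OF two_nonadjacent[OF w0], of p q "(M, 0)"] pq(2) neg[of p] neg[of q] M by auto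
  qed
  note L0 = occurrence_0[OF L(2)]
  have Lp: "L - fst p \<in> T"
  proof (rule ccontr)
    assume a: "L - fst p \<notin> T"
    have "p \<in> nonadj (L, 0)" "q \<in> nonadj (L, 0)"
      using a neg[of p] neg[of q] eq L by auto
    moreover have "(fst p + L, 0) \<in> nonadj (L, 0)"
      using neg[of p] occurrence_0[OF pL] by auto
    moreover have "p \<noteq> (fst p + L, 0)" "q \<noteq> (fst p + L, 0)"
      using L eq by (metis add_cancel_left_right fst_conv less_irrefl)+
    ultimately show False
      using three_in_pair[OF two_nonadjacent[OF L0], of p q "(fst p + L, 0)"] pq(2) by blast
  qed
  \<comment> \<open>This is a third start, positive and so different from \<open>w\<close> and
    \<open>fst p\<close>.\<close>
  have "L - fst p \<in> {t \<in> T. t - L \<notin> T}" using Lp neg[of p] by auto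
  then show False using no3[of w "fst p" "L - fst p"] wst pst neg[of p] neg'[of p] L by auto
qed

text \<open>With 0 absent, two copies of a value are joined in \<open>H\<close>, and they share
  every further neighbour, which gives a triangle.\<close>

lemma inj_on_fst: "inj_on fst (occurrences S)"
proof (rule inj_onI, rule ccontr)
  fix p q assume p: "p \<in> occurrences S" and q: "q \<in> occurrences S"
    and eq: "fst p = fst q" and ne: "p \<noteq> q"
  obtain r where "r \<in> nonadj p" "r \<noteq> q"
    using other_in_pair[OF two_nonadjacent[OF p]] by blast
  then show False
    using triangle_free[OF p q, of r] zero_notin eq ne by auto
qed

lemma contradiction: False
proof -
  have card: "card T = card (occurrences S)"
    using card_image[OF inj_on_fst] by (simp add: fst_occurrences)
  have deg: "card {y \<in> T. x \<noteq> y \<and> \<bar>x - y\<bar> \<notin> T} = 2" if "x \<in> T" for x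
  proof -
    have "x \<in> fst ` occurrences S" using that by (simp add: fst_occurrences)
    then obtain p where p: "p \<in> occurrences S" "x = fst p" by blast
    have "{y \<in> T. x \<noteq> y \<and> \<bar>x - y\<bar> \<notin> T} = fst ` nonadj p"
    proof (intro equalityI subsetI)
      fix y assume y: "y \<in> {y \<in> T. x \<noteq> y \<and> \<bar>x - y\<bar> \<notin> T}"
      then have "(y, 0) \<in> nonadj p" using p occurrence_0[of y S] by auto
      then show "y \<in> fst ` nonadj p" by force
    next
      fix y assume "y \<in> fst ` nonadj p"
      then obtain q where "q \<in> nonadj p" "y = fst q" by blast
      then show "y \<in> {y \<in> T. x \<noteq> y \<and> \<bar>x - y\<bar> \<notin> T}"
        using p fst_mem inj_onD[OF inj_on_fst, of p q] by auto
    qed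
    moreover have "inj_on fst (nonadj p)"
      using inj_on_fst by (rule inj_on_subset) auto
    ultimately show ?thesis using two_nonadjacent[OF p(1)] by (simp add: card_image)
  qed
  have tri: "\<bar>y - z\<bar> \<in> T" if "x \<in> T" "y \<in> T" "z \<in> T" "x \<noteq> y" "y \<noteq> z" "x \<noteq> z"
      "\<bar>x - y\<bar> \<notin> T" "\<bar>x - z\<bar> \<notin> T" for x y z
    using triangle_free[of "(x, 0)" "(y, 0)" "(z, 0)"] that by (simp add: occurrence_0)
  have w: "Min T \<in> T" "\<And>x. x \<in> T \<Longrightarrow> Min T \<le> x" using T_ne by auto
  have c8: "card T \<ge> 8" "even (card T)" using card card_ge_8 card_even by simp_all
  consider "Min T > 0" | "Min T < 0" using w zero_notin by (metis linorder_neqE)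
  then show False
  proof cases
    case 1
    then have "x > 0" if "x \<in> T" for x using w(2)[OF that] by linarith
    then show False using positive_set_not_2_regular[of T] c8 deg tri by blast
  next
    case 2
    have "\<exists>t \<in> T. t \<noteq> Min T"
    proof (rule ccontr)
      assume "\<not> ?thesis"
      then have "T \<subseteq> {Min T}" by blast
      then have "card T \<le> 1" using card_mono[of "{Min T}" T] by simp
      then show False using c8 by simp
    qed
    then have "- Min T \<in> T" using neg_Min_mem 2 by blast
    then show False
      using negative_min_set_not_2_regular[of T "- Min T"] c8 deg zero_notin w 2 by simp
  qed
qed

end

section \<open>Cycles\<close>

lemma mem_cycle_edges_iff:
  assumes "distinct xs" "i < length xs" "j < length xs"
  shows "{xs ! i, xs ! j} \<in> cycle_edges xs \<longleftrightarrow> j = Suc i mod length xs \<or> i = Suc j mod length xs"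
proof -
  have "Suc k mod length xs < length xs" for k using assms(2) by (intro mod_less_divisor) auto
  then show ?thesis
    using assms by (auto simp: cycle_edges_def doubleton_eq_iff nth_eq_iff_index_eq)
qed

lemma cycle_edges_subset_set: "e \<in> cycle_edges xs \<Longrightarrow> e \<subseteq> set xs"
proof -
  assume "e \<in> cycle_edges xs"
  then obtain i where i: "i < length xs" "e = {xs ! i, xs ! (Suc i mod length xs)}"
    by (auto simp: cycle_edges_def)
  moreover from this have "Suc i mod length xs < length xs" by (intro mod_less_divisor) auto
  ultimately show "e \<subseteq> set xs" by simp
qed

lemma cycle_degree:
  assumes "distinct xs" "length xs \<ge> 3" "u \<in> set xs"
  shows "card {v. {u, v} \<in> cycle_edges xs} = 2"
proof -
  obtain i where i: "i < length xs" "u = xs ! i" using assms(3) by (metis in_set_conv_nth)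
  define m where "m = length xs"
  \<comment> \<open>Cyclic successor and predecessor of \<open>i\<close>, which differ because the
    length is at least 3.\<close>
  define a b where "a = (if Suc i = m then 0 else Suc i)" and "b = (if i = 0 then m - 1 else i - 1)"
  have ab: "a < m" "b < m" "a \<noteq> b" using i assms(2) by (auto simp: a_def b_def m_def)
  have adj: "j = Suc i mod m \<or> i = Suc j mod m \<longleftrightarrow> j = a \<or> j = b" if "j < m" for j
    using that i assms(2) by (auto simp: mod_Suc a_def b_def m_def)
  have "{v. {u, v} \<in> cycle_edges xs} = {xs ! a, xs ! b}"
  proof (intro equalityI subsetI)
    fix v assume v: "v \<in> {v. {u, v} \<in> cycle_edges xs}"
    then have "v \<in> set xs" using cycle_edges_subset_set by fastforce
    then obtain j where "j < length xs" "v = xs ! j" by (metis in_set_conv_nth)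
    then show "v \<in> {xs ! a, xs ! b}"
      using v i adj[of j] mem_cycle_edges_iff[OF assms(1) i(1)] by (auto simp: m_def)
  next
    fix v assume "v \<in> {xs ! a, xs ! b}"
    then obtain j where "j = a \<or> j = b" "v = xs ! j" by blast
    then show "v \<in> {v. {u, v} \<in> cycle_edges xs}"
      using i adj[of j] ab mem_cycle_edges_iff[OF assms(1) i(1), of j] by (auto simp: m_def)
  qed
  then show ?thesis using ab assms(1) by (simp add: nth_eq_iff_index_eq m_def)
qed

lemma cycle_triangle_free:
  assumes "distinct xs" "length xs \<ge> 4" "v \<noteq> w"
    "{u, v} \<in> cycle_edges xs" "{u, w} \<in> cycle_edges xs"
  shows "{v, w} \<notin> cycle_edges xs"
proof -
  have "u \<in> set xs" "v \<in> set xs" "w \<in> set xs"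
    using assms(4,5) cycle_edges_subset_set by fastforce+
  then obtain i j k where "i < length xs" "u = xs ! i" "j < length xs" "v = xs ! j"
    "k < length xs" "w = xs ! k" by (metis in_set_conv_nth)
  then show ?thesis
    using assms by (auto simp: mem_cycle_edges_iff mod_Suc split: if_splits)
qed

section \<open>Transfer from the two cycles to the signature\<close>

theorem theorem2:
  fixes n :: nat and V :: "'a set" and E :: "'a set set" and xs ys :: "'a list"
  assumes "n \<ge> 8" and "even n"
    and "finite V" and "card V = n"
    and "is_cycle V ([V]\<^bsup>2\<^esup>) xs" and "length xs = n div 2"
    and "is_cycle V ([V]\<^bsup>2\<^esup>) ys" and "length ys = n div 2"
    and "set xs \<inter> set ys = {}"
    and "E = [V]\<^bsup>2\<^esup> - (cycle_edges xs \<union> cycle_edges ys)"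
  shows "\<not> autograph V E"
proof
  assume "autograph V E"
  then obtain S where "autograph_with_signature V E S" by (auto simp: autograph_def)
  then obtain \<pi> where \<pi>: "bij_betw \<pi> (occurrences S) V \<and>
      (\<forall>p \<in> occurrences S. \<forall>q \<in> occurrences S. p \<noteq> q \<longrightarrow>
        ({\<pi> p, \<pi> q} \<in> E \<longleftrightarrow> \<bar>fst p - fst q\<bar> \<in># S))"
    unfolding autograph_with_signature_def by (rule exE)
  then have bij: "bij_betw \<pi> (occurrences S) V" by simp
  have adj: "{\<pi> p, \<pi> q} \<in> E \<longleftrightarrow> \<bar>fst p - fst q\<bar> \<in># S"
    if "p \<in> occurrences S" "q \<in> occurrences S" "p \<noteq> q" for p q
    using that \<pi> by simp
  define F where "F = cycle_edges xs \<union> cycle_edges ys"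
  have cyc: "distinct xs" "distinct ys" "set xs \<subseteq> V" "set ys \<subseteq> V"
    using assms by (auto simp: is_cycle_def)
  have len: "length xs \<ge> 4" "length ys \<ge> 4" using assms by linarith+
  \<comment> \<open>The disjoint cycles have \<open>n div 2\<close> vertices each, and
    \<open>n\<close> is even, so they exhaust \<open>V\<close>.\<close>
  have V: "V = set xs \<union> set ys"
  proof (rule sym, rule card_subset_eq)
    have "n div 2 + n div 2 = n" using assms(2) by auto
    then show "card (set xs \<union> set ys) = card V"
      using assms cyc by (simp add: card_Un_disjoint distinct_card)
  qed (use assms cyc in auto)
  have Fx: "{u, v} \<in> F \<longleftrightarrow> {u, v} \<in> cycle_edges xs" if "u \<in> set xs" for u v
    using that cycle_edges_subset_set[of "{u, v}" ys] assms(9) by (auto simp: F_def)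
  have Fy: "{u, v} \<in> F \<longleftrightarrow> {u, v} \<in> cycle_edges ys" if "u \<in> set ys" for u v
    using that cycle_edges_subset_set[of "{u, v}" xs] assms(9) by (auto simp: F_def)
  have FV: "{u, v} \<in> F \<Longrightarrow> v \<in> V" for u v
    using cycle_edges_subset_set[of "{u, v}" xs] cycle_edges_subset_set[of "{u, v}" ys] V
    by (auto simp: F_def)
  have Fne: "u \<noteq> v" if "{u, v} \<in> F" for u v
    using that cycle_edges_complete[of xs V] cycle_edges_complete[of ys V] cyc len
    by (auto simp: F_def nsets_def)
  have degree: "card {v. {u, v} \<in> F} = 2" if "u \<in> V" for u
    using that cycle_degree[of xs u] cycle_degree[of ys u] cyc len Fx Fy V by auto
  have triangle: "{v, w} \<notin> F" if "u \<in> V" "v \<noteq> w" "{u, v} \<in> F" "{u, w} \<in> F" for u v w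
  proof (cases "u \<in> set xs")
    case True
    then have "v \<in> set xs" using that Fx cycle_edges_subset_set[of "{u, v}" xs] by auto
    then show ?thesis using True that Fx cycle_triangle_free[of xs v w u] cyc len by blast
  next
    case False
    then have u: "u \<in> set ys" using that V by blast
    then have "v \<in> set ys" using that Fy cycle_edges_subset_set[of "{u, v}" ys] by auto
    then show ?thesis using u that Fy cycle_triangle_free[of ys v w u] cyc len by blast
  qed
  have closed: "u \<in> set xs \<longleftrightarrow> v \<in> set xs" if "{u, v} \<in> F" for u v
    using that cycle_edges_subset_set[of "{u, v}" xs] cycle_edges_subset_set[of "{u, v}" ys] assms(9)
    by (auto simp: F_def)
  have \<pi>V: "\<pi> p \<in> V" if "p \<in> occurrences S" for p
    using bij that by (auto simp: bij_betw_def)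
  have inj: "\<pi> p = \<pi> q \<longleftrightarrow> p = q" if "p \<in> occurrences S" "q \<in> occurrences S" for p q
    using bij that by (auto simp: bij_betw_def dest: inj_onD)
  have nonadj: "\<bar>fst p - fst q\<bar> \<notin># S \<longleftrightarrow> {\<pi> p, \<pi> q} \<in> F"
    if pq: "p \<in> occurrences S" "q \<in> occurrences S" "p \<noteq> q" for p q
  proof -
    have "{\<pi> p, \<pi> q} \<in> [V]\<^bsup>2\<^esup>" using pq \<pi>V inj by (auto simp: nsets_def)
    then show ?thesis using adj[OF pq] assms(10) by (auto simp: F_def)
  qed
  have surj: "\<exists>p \<in> occurrences S. \<pi> p = u" if "u \<in> V" for u
    using bij that by (auto simp: bij_betw_def)
  \<comment> \<open>The first cycle serves as \<open>C\<close>, since no edge of \<open>F\<close>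
    leaves it.\<close>
  interpret signature_of_two_cycles_complement S "{p. \<pi> p \<in> set xs}"
  proof
    fix p assume p: "p \<in> occurrences S"
    let ?N = "{q \<in> occurrences S. p \<noteq> q \<and> \<bar>fst p - fst q\<bar> \<notin># S}"
    have img: "\<pi> ` ?N = {v. {\<pi> p, v} \<in> F}"
    proof (intro equalityI subsetI)
      fix v assume v: "v \<in> {v. {\<pi> p, v} \<in> F}"
      then obtain q where "q \<in> occurrences S" "\<pi> q = v" using surj FV by blast
      then show "v \<in> \<pi> ` ?N" using v p nonadj Fne by blast
    next
      fix v assume "v \<in> \<pi> ` ?N"
      then obtain q where "q \<in> ?N" "v = \<pi> q" by blast
      then show "v \<in> {v. {\<pi> p, v} \<in> F}" using nonadj[OF p, of q] by simp
    qed
    have "inj_on \<pi> ?N" using inj by (auto intro: inj_onI)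
    from card_image[OF this] show "card ?N = 2"
      unfolding img using degree[OF \<pi>V[OF p]] by simp
  next
    fix p q r
    assume "p \<in> occurrences S" "q \<in> occurrences S" "r \<in> occurrences S" "p \<noteq> q" "q \<noteq> r" "p \<noteq> r"
      "\<bar>fst p - fst q\<bar> \<notin># S" "\<bar>fst p - fst r\<bar> \<notin># S"
    then show "\<bar>fst q - fst r\<bar> \<in># S"
      using triangle[of "\<pi> p" "\<pi> q" "\<pi> r"] nonadj[of p q] nonadj[of p r] nonadj[of q r]
        \<pi>V[of p] inj[of q r] by simp
  next
    fix p q
    assume "p \<in> occurrences S" "q \<in> occurrences S" "p \<noteq> q" "\<bar>fst p - fst q\<bar> \<notin># S"
    then show "p \<in> {p. \<pi> p \<in> set xs} \<longleftrightarrow> q \<in> {p. \<pi> p \<in> set xs}"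
      using nonadj[of p q] closed[of "\<pi> p" "\<pi> q"] by simp
  next
    obtain x y where xy: "x \<in> set xs" "y \<in> set ys" using len by (cases xs; cases ys) auto
    then show "\<exists>p \<in> occurrences S. p \<in> {p. \<pi> p \<in> set xs}"
      "\<exists>p \<in> occurrences S. p \<notin> {p. \<pi> p \<in> set xs}"
      using surj[of x] surj[of y] cyc assms(9) by auto
    show "even (card (occurrences S))" "card (occurrences S) \<ge> 8"
      using bij_betw_same_card[OF bij] assms by simp_all
  qed
  show False by (rule contradiction)
qed

end
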